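(* Let $m\ge 4$ be an integer. (i) For each integer $r\ge 2$ such that $\frac1r+\frac1m\ne\frac12$, and each $n\in r\mathbb{Z}_{>0}$ with $n\ge 2r$, the equation $\mathcal{L}^{(1)}_n f=0$ admits a unique polynomial solution $f(c)\in\mathbb{C}[c]$ up to nonzero scalar multiples (i.e. its space of polynomial solutions is one-dimensional), namely the type 1 polynomial $P_{-2r,n-2r}(c)$. (ii) For each integer $r\ge 2$ and each $n\in r\mathbb{Z}_{>0}$ with $n\ge r$, the equation $\mathcal{L}^{(2)}_n f=0$ admits a unique polynomial solution $f(c)\in\mathbb{C}[c]$ up to nonzero scalar multiples (i.e. its space of polynomial solutions is one-dimensional), namely the type 2 polynomial $P_{-r,n-2r}(c)$.
   Context: For integers $r,m\ge 2$ and an integer $n$, define for $i=1,2$ the differential operator (derivatives in $c$) $$\mathcal{L}^{(i)}_nf=(c^2-1)^2m^2r^4f^{(\mathrm{iv})}+10c(c^2-1)m^2r^4f'''+\bigl[X^{(i)}_nc^2+Y^{(i)}_n\bigr]f''+Z^{(i)}_n\,c\,f'+W^{(i)}_nf,$$ with $$W^{(1)}_n=n(n-2r)\bigl(m(n-2r+2)+2r\bigr)\bigl(m(n-4r+2)+2r\bigr),$$ $$X^{(1)}_n=r^2\bigl(-2m^2((n+2)n+2)+4mr(m(2n+3)-n-2)+r^2(3m(5m+4)-4)\bigr),$$ $$Y^{(1)}_n=r^2\bigl(2m^2((n+2)n+2)-4mr(m(2n+3)-n-2)-16mr^2\bigr),$$ $$Z^{(1)}_n=-3r^2\bigl(m^2(-8nr+2(n+2)n+5r^2-12r+4)+4mr(n-3r+2)+4r^2\bigr),$$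 and, with $\Delta=r^2(r-2)m(2mn-7mr+2m+4r)$, $$W^{(2)}_n=(n^2-r^2)\bigl(m(n-5r+2)+2r\bigr)\bigl(m(n-3r+2)+2r\bigr),$$ $$X^{(2)}_n=-2r^2\bigl(m^2((n-r)(n-2r)-10r^2)+2mr(n-3r)+2r^2\bigr)+\Delta,$$ $$Y^{(2)}_n=2r^2\bigl(m^2((n-r)(n-2r)-(2r^2+r))+2mr(n-4r)\bigr)-r^2(r-2)m\bigl(2mn-6mr+2m+4r\bigr),$$ $$Z^{(2)}_n=-3r^2\bigl(2m^2(n-r)(n-2r)+4mr(n-3r)+4r^2\bigr)+3\Delta.$$ Consider sequences of polynomials $(P_k(c))_{k\ge -2r}$ in $\mathbb{C}[c]$ satisfying, for all integers $k\ge 0$, $$(2r+m+km)P_k(c)=2c\,(r+(1+k-r)m)\,P_{k-r}(c)-(k-(2r-1))\,m\,P_{k-2r}(c);$$ such a sequence is determined by $P_{-2r},\dots,P_{-1}$. The type 1 family $P_{-2r,k}(c)$, $k\ge-2r$, is the solution with $P_{-2r}=1$ and $P_j=0$ for $j\in\{-2r+1,\dots,-1\}$. The type 2 family $P_{-r,k}(c)$, $k\ge-2r$, is the solution with $P_{-r}=1$ and $P_j=0$ for $j\in\{-2r,\dots,-1\}$, $j\neq -r$.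
   Formalization: In (ii), uniqueness (one-dimensionality) is claimed only when 1/r+1/m≠1/2, as in (i); it fails otherwise, e.g. for m=r=n=4 both 1 and c are solutions. That the type 2 polynomial is a nonzero solution is still proved for every r≥2. *)

theory Defs
  imports Complex_Main "HOL-Computational_Algebra.Polynomial"
begin

text \<open>The variable $c$ of $\mathbb{C}[c]$.\<close>

abbreviation cvar :: "complex poly" where
  "cvar \<equiv> [:0, 1:]"

definition diff_op ::
    "int \<Rightarrow> int \<Rightarrow> int \<Rightarrow> int \<Rightarrow> int \<Rightarrow> int \<Rightarrow> complex poly \<Rightarrow> complex poly" where
  "diff_op r m X Y Z W f =
     of_int (m^2 * r^4) * (cvar^2 - 1)^2 * (pderiv ^^ 4) f
   + of_int (10 * m^2 * r^4) * cvar * (cvar^2 - 1) * (pderiv ^^ 3) f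
   + (of_int X * cvar^2 + of_int Y) * (pderiv ^^ 2) f
   + of_int Z * cvar * pderiv f
   + of_int W * f"

definition W1 :: "int \<Rightarrow> int \<Rightarrow> int \<Rightarrow> int" where
  "W1 r m n = n * (n - 2*r) * (m*(n - 2*r + 2) + 2*r) * (m*(n - 4*r + 2) + 2*r)"

definition X1 :: "int \<Rightarrow> int \<Rightarrow> int \<Rightarrow> int" where
  "X1 r m n = r^2 * (- 2*m^2*((n + 2)*n + 2) + 4*m*r*(m*(2*n + 3) - n - 2)
                     + r^2*(3*m*(5*m + 4) - 4))"

definition Y1 :: "int \<Rightarrow> int \<Rightarrow> int \<Rightarrow> int" where
  "Y1 r m n = r^2 * (2*m^2*((n + 2)*n + 2) - 4*m*r*(m*(2*n + 3) - n - 2) - 16*m*r^2)"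

definition Z1 :: "int \<Rightarrow> int \<Rightarrow> int \<Rightarrow> int" where
  "Z1 r m n = - 3*r^2 * (m^2*(- 8*n*r + 2*(n + 2)*n + 5*r^2 - 12*r + 4)
                         + 4*m*r*(n - 3*r + 2) + 4*r^2)"

definition Delta :: "int \<Rightarrow> int \<Rightarrow> int \<Rightarrow> int" where
  "Delta r m n = r^2 * (r - 2) * m * (2*m*n - 7*m*r + 2*m + 4*r)"

definition W2 :: "int \<Rightarrow> int \<Rightarrow> int \<Rightarrow> int" where
  "W2 r m n = (n^2 - r^2) * (m*(n - 5*r + 2) + 2*r) * (m*(n - 3*r + 2) + 2*r)"

definition X2 :: "int \<Rightarrow> int \<Rightarrow> int \<Rightarrow> int" where
  "X2 r m n = - 2*r^2 * (m^2*((n - r)*(n - 2*r) - 10*r^2) + 2*m*r*(n - 3*r) + 2*r^2)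
              + Delta r m n"

definition Y2 :: "int \<Rightarrow> int \<Rightarrow> int \<Rightarrow> int" where
  "Y2 r m n = 2*r^2 * (m^2*((n - r)*(n - 2*r) - (2*r^2 + r)) + 2*m*r*(n - 4*r))
              - r^2 * (r - 2) * m * (2*m*n - 6*m*r + 2*m + 4*r)"

definition Z2 :: "int \<Rightarrow> int \<Rightarrow> int \<Rightarrow> int" where
  "Z2 r m n = - 3*r^2 * (2*m^2*(n - r)*(n - 2*r) + 4*m*r*(n - 3*r) + 4*r^2)
              + 3 * Delta r m n"

definition L1 :: "int \<Rightarrow> int \<Rightarrow> int \<Rightarrow> complex poly \<Rightarrow> complex poly" where
  "L1 r m n = diff_op r m (X1 r m n) (Y1 r m n) (Z1 r m n) (W1 r m n)"

definition L2 :: "int \<Rightarrow> int \<Rightarrow> int \<Rightarrow> complex poly \<Rightarrow> complex poly" where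
  "L2 r m n = diff_op r m (X2 r m n) (Y2 r m n) (Z2 r m n) (W2 r m n)"

text \<open>
  Sequences indexed by the integers \<open>k \<ge> -2r\<close> are functions on all of \<open>int\<close>; the values
  below \<open>-2r\<close> are irrelevant.
\<close>

definition satisfies_recurrence :: "int \<Rightarrow> int \<Rightarrow> (int \<Rightarrow> complex poly) \<Rightarrow> bool" where
  "satisfies_recurrence r m P \<longleftrightarrow>
     (\<forall>k\<ge>0. of_int (2*r + m + k*m) * P k =
        2 * cvar * of_int (r + (1 + k - r)*m) * P (k - r)
        - of_int ((k - (2*r - 1)) * m) * P (k - 2*r))"

text \<open>
  The solution with prescribed values \<open>init\<close> at the negative indices. The guard
  \<open>r \<le> 0\<close> only serves termination.
\<close>

function rec_solution :: "int \<Rightarrow> int \<Rightarrow> (int \<Rightarrow> complex poly) \<Rightarrow> int \<Rightarrow> complex poly" where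
  "rec_solution r m init k =
     (if k < 0 \<or> r \<le> 0 then init k
      else smult (1 / of_int (2*r + m + k*m))
        (2 * cvar * of_int (r + (1 + k - r)*m) * rec_solution r m init (k - r)
         - of_int ((k - (2*r - 1)) * m) * rec_solution r m init (k - 2*r)))"
  by pat_completeness auto
termination
  by (relation "measure (\<lambda>(r, m, init, k). nat (k + 1))") auto

declare rec_solution.simps [simp del]

definition type1 :: "int \<Rightarrow> int \<Rightarrow> int \<Rightarrow> complex poly" where
  "type1 r m = rec_solution r m (\<lambda>j. if j = - 2*r then 1 else 0)"

definition type2 :: "int \<Rightarrow> int \<Rightarrow> int \<Rightarrow> complex poly" where
  "type2 r m = rec_solution r m (\<lambda>j. if j = - r then 1 else 0)"

lemma rec_solution_neg: "k < 0 \<Longrightarrow> rec_solution r m init k = init k"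
  by (simp add: rec_solution.simps)

lemma of_int_mult_poly: "of_int a * (p :: complex poly) = smult (of_int a) p"
  by (simp add: of_int_poly)

lemma rec_solution_satisfies_recurrence:
  assumes "r \<ge> 2" "m \<ge> 2"
  shows "satisfies_recurrence r m (rec_solution r m init)"
  unfolding satisfies_recurrence_def
proof (intro allI impI)
  fix k :: int
  assume k: "k \<ge> 0"
  then have "2*r + m + k*m > 0"
    using assms by (smt (verit) mult_nonneg_nonneg)
  then have nz: "(of_int (2*r + m + k*m) :: complex) \<noteq> 0"
    by (metis less_irrefl of_int_eq_0_iff)
  have "rec_solution r m init k = smult (1 / of_int (2*r + m + k*m))
        (2 * cvar * of_int (r + (1 + k - r)*m) * rec_solution r m init (k - r)
         - of_int ((k - (2*r - 1)) * m) * rec_solution r m init (k - 2*r))"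
    using k assms by (subst rec_solution.simps) simp
  then show "of_int (2*r + m + k*m) * rec_solution r m init k =
        2 * cvar * of_int (r + (1 + k - r)*m) * rec_solution r m init (k - r)
        - of_int ((k - (2*r - 1)) * m) * rec_solution r m init (k - 2*r)"
    using nz by (simp only: of_int_mult_poly smult_smult) simp
qed

lemma recurrence_determined:
  assumes r: "r \<ge> 2" and m: "m \<ge> 2"
    and P: "satisfies_recurrence r m P" and Q: "satisfies_recurrence r m Q"
    and init: "\<And>j. - 2*r \<le> j \<Longrightarrow> j < 0 \<Longrightarrow> P j = Q j"
    and "- 2*r \<le> k"
  shows "P k = Q k"
  using \<open>- 2*r \<le> k\<close>
proof (induction "nat (k + 2*r)" arbitrary: k rule: less_induct)
  case less
  show ?case
  proof (cases "k < 0")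
    case True
    then show ?thesis using init less.prems by simp
  next
    case False
    then have "2*r + m + k*m > 0"
      using r m by (smt (verit) mult_nonneg_nonneg)
    then have nz: "(of_int (2*r + m + k*m) :: complex poly) \<noteq> 0"
      by (metis less_irrefl of_int_eq_0_iff)
    have "P (k - r) = Q (k - r)" "P (k - 2*r) = Q (k - 2*r)"
      using less.hyps[of "k - r"] less.hyps[of "k - 2*r"] False r by auto
    then have "of_int (2*r + m + k*m) * P k = of_int (2*r + m + k*m) * Q k"
      using P Q False unfolding satisfies_recurrence_def by (metis not_less)
    then show ?thesis using nz by (metis mult_left_cancel)
  qed
qed

definition poly_solutions :: "(complex poly \<Rightarrow> complex poly) \<Rightarrow> complex poly set" where
  "poly_solutions L = {f. L f = 0}"

text \<open>
  When \<open>1/r + 1/m = 1/2\<close> with \<open>m \<ge> 4\<close>, that is \<open>(r, m) = (4, 4)\<close> or \<open>(3, 6)\<close>,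
  uniqueness up to scalars already fails for \<open>L2\<close> at \<open>n = r\<close>: both \<open>1\<close> and \<open>c\<close> are solutions.
\<close>

lemma L2_not_unique:
  "1 \<in> poly_solutions (L2 4 4 4)" "cvar \<in> poly_solutions (L2 4 4 4)"
  "1 \<in> poly_solutions (L2 3 6 3)" "cvar \<in> poly_solutions (L2 3 6 3)"
  by (simp_all add: poly_solutions_def L2_def diff_op_def X2_def Y2_def Z2_def W2_def Delta_def
      numeral_eq_Suc pderiv_pCons)

end

theory Submission
  imports Defs
begin

text \<open>
  Along the indices divisible by \<open>r\<close>, and after division by \<open>r m\<close>, the recurrence reads
  \[ (n + 2 + t - p) y_{n+2} = 2 (n + 1 + t) c y_{n+1} - (n + t + p) y_n , \]
  with \<open>p = -1/m\<close> and \<open>t = 1/r + 1/m - 2\<close>.  This is the Gegenbauer recurrence of parameter \<open>p\<close>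
  with the degree shifted by \<open>t - p\<close>, so its polynomial solutions are associated Gegenbauer
  polynomials.  The type 2 family is the solution starting with \<open>0, 1\<close>.  The type 1 family starts
  with \<open>1, 0\<close>, followed by a nonzero constant; dropping its first term gives a multiple of the
  solution starting with \<open>0, 1\<close> for \<open>t + 1\<close> in place of \<open>t\<close>.  Both parts of the theorem are
  therefore statements about one polynomial \<open>A\<^sub>n\<close> depending on \<open>(p, t)\<close>.

  The fourth order equation has the following origin.  A solution of the shifted recurrence with
  constant initial values is a combination of products of a Gegenbauer function of shifted degree \<open>n\<close>
  with one of shifted degree \<open>0\<close>.  Put \<open>c = cos \<theta>\<close> and \<open>s = n + t\<close>.  In normal form these two
  factors satisfy \<open>\<phi>'' = -(s\<^sup>2 + l / sin\<^sup>2 \<theta>) \<phi>\<close> and \<open>\<psi>'' = -(t\<^sup>2 + l / sin\<^sup>2 \<theta>) \<psi>\<close>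
  with \<open>l = p (1 - p)\<close>, and \<open>A\<^sub>n\<close> behaves like \<open>\<phi> \<psi> / sin \<theta>\<close>.  Products of solutions of two
  second order equations span a space closed under differentiation, of dimension four:
  \<open>\<phi> \<psi>\<close>, \<open>\<phi>' \<psi>\<close>, \<open>\<phi> \<psi>'\<close>, \<open>\<phi>' \<psi>'\<close>.  Eliminating the last three gives
  \[ (H - s^2 - t^2)^2 f - 4 s^2 t^2 f + 4 l f'' = 0, \qquad H = (c^2 - 1) \partial^2 + 3 c \partial + 1 , \]
  and both \<open>L1\<close> and \<open>L2\<close> are \<open>m\<^sup>2 r\<^sup>4\<close> times this operator (\<open>L1_eq_product_op\<close>,
  \<open>L2_eq_product_op\<close>).  The functions \<open>\<phi>\<close> and \<open>\<psi>\<close> never enter the formal argument: polynomials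
  \<open>A\<close>, \<open>F\<close>, \<open>G\<close>, \<open>K\<close> take the place of the four products, and their differential
  system comes from ladder relations proved by induction along the recurrence
  (\<open>assoc_gegenbauer_ladder\<close>, \<open>ladder_imp_tensor_system\<close>, \<open>fourth_order_equation\<close>).

  For uniqueness, \<open>H\<close> multiplies the leading coefficient of a polynomial of degree \<open>d\<close> by \<open>(d + 1)\<^sup>2\<close>,
  so a nonzero polynomial solution has \<open>d + 1 = \<plusminus>(s - t)\<close> or \<open>d + 1 = \<plusminus>(s + t)\<close>.
  With \<open>n\<close> the index in the recurrence above, \<open>s - t = n\<close> and \<open>s + t = n + 2 t\<close>.  Since \<open>0 < 1/r + 1/m < 1\<close>, the number \<open>2 t\<close> is an
  integer only if \<open>1/r + 1/m = 1/2\<close>.  Otherwise all nonzero polynomial solutions have the same degree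
  \<open>n - 1\<close>, and two of them must be proportional (\<open>poly_solutions_line\<close>).
\<close>

section \<open>The operator and its polynomial kernel\<close>

text \<open>
  The operator \<open>H\<close> whose eigenvectors are the Chebyshev polynomials of the second kind:
  in terms of \<open>c = cos \<theta>\<close> it sends \<open>f / sin \<theta>\<close> to \<open>- f'' / sin \<theta>\<close>.
\<close>

definition cheb_op :: "complex poly \<Rightarrow> complex poly" where
  "cheb_op f = (cvar^2 - 1) * pderiv (pderiv f) + 3 * cvar * pderiv f + f"

text \<open>
  The square of \<open>H - s\<^sup>2 - t\<^sup>2\<close>, less \<open>4 s\<^sup>2 t\<^sup>2\<close>, plus \<open>4 p (1 - p) \<partial>\<^sup>2\<close>: the equation
  satisfied by products of Gegenbauer functions of parameter \<open>p\<close> with spectral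
  parameters \<open>s\<close> and \<open>t\<close>.
\<close>

definition product_op :: "complex \<Rightarrow> complex \<Rightarrow> complex \<Rightarrow> complex poly \<Rightarrow> complex poly" where
  "product_op p s t f = cheb_op (cheb_op f) - smult (2 * (s^2 + t^2)) (cheb_op f)
     + smult ((s^2 - t^2)^2) f + smult (4 * p * (1 - p)) (pderiv (pderiv f))"

lemma pderiv_one_minus_sq: "pderiv (1 - cvar^2) = - 2 * cvar"
  by (simp add: pderiv_diff power2_eq_square pderiv_mult pderiv_pCons numeral_poly)

lemma pderiv_cvar: "pderiv cvar = (1 :: complex poly)"
  by (simp add: pderiv_pCons)

lemma coeff_cheb_op:
  "coeff (cheb_op f) k = (of_nat k + 1)^2 * coeff f k - (of_nat k + 1) * (of_nat k + 2) * coeff f (k + 2)"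
proof -
  have "cheb_op f = pCons 0 (pCons 0 (pderiv (pderiv f))) - pderiv (pderiv f) + smult 3 (pCons 0 (pderiv f)) + f"
    by (simp add: cheb_op_def power2_eq_square numeral_poly algebra_simps)
  then show ?thesis
    by (simp only:) (simp add: coeff_pCons coeff_pderiv power2_eq_square algebra_simps split: nat.split)
qed

text \<open>
  The indicial equation at infinity: only the square of \<open>H\<close>, \<open>H\<close> and the identity contribute to
  the leading coefficient, so \<open>H\<close> may be replaced by the number \<open>(d + 1)\<^sup>2\<close>.
\<close>

lemma degree_product_op_kernel:
  assumes f: "product_op p s t f = 0" "f \<noteq> 0"
  shows "((of_nat (degree f) + 1)^2 - (s + t)^2) * ((of_nat (degree f) + 1)^2 - (s - t)^2) = 0"
proof -
  define d where "d = degree f"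
  have [simp]: "coeff f k = 0" if "k > d" for k
    using that by (intro coeff_eq_0) (simp add: d_def)
  have "coeff (product_op p s t f) d
     = ((of_nat d + 1)^2 - (s + t)^2) * ((of_nat d + 1)^2 - (s - t)^2) * coeff f d"
    by (simp add: product_op_def coeff_cheb_op coeff_pderiv) algebra
  moreover have "coeff f d \<noteq> 0" using f by (simp add: d_def)
  ultimately show ?thesis using f unfolding d_def by simp
qed

lemma product_op_diff_smult:
  "product_op p s t (f - smult a g) = product_op p s t f - smult a (product_op p s t g)"
proof -
  have cheb_op: "cheb_op (f - smult a g) = cheb_op f - smult a (cheb_op g)" for f g
    by (simp add: cheb_op_def pderiv_diff pderiv_smult smult_diff_right smult_add_right algebra_simps)
  then show ?thesis
    by (simp add: product_op_def cheb_op pderiv_diff pderiv_smult smult_diff_right smult_add_right algebra_simps)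
qed

text \<open>
  Two solutions of the same degree have a combination of smaller degree, which must vanish.
\<close>

lemma poly_solutions_line:
  assumes lin: "\<And>f g a. L (f - smult a g) = L f - smult a (L g)"
    and P: "P \<noteq> 0" "L P = 0"
    and deg: "\<And>f. L f = 0 \<Longrightarrow> f \<noteq> 0 \<Longrightarrow> degree f = d"
  shows "poly_solutions L = range (\<lambda>a. smult a P)"
    and "vector_space.dim smult (poly_solutions L) = 1"
proof -
  show line: "poly_solutions L = range (\<lambda>a. smult a P)"
  proof (intro equalityI subsetI)
    fix f assume "f \<in> poly_solutions L"
    then have f: "L f = 0" by (simp add: poly_solutions_def)
    define a where "a = coeff f d / coeff P d"
    have P0: "coeff P d \<noteq> 0" using deg[OF P(2,1)] P(1) by force
    have "f - smult a P = 0"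
    proof (rule ccontr)
      assume ne: "f - smult a P \<noteq> 0"
      have "L (f - smult a P) = 0" using lin f P by simp
      then have "degree (f - smult a P) = d" using ne deg by blast
      moreover have "coeff (f - smult a P) d = 0" using P0 by (simp add: a_def)
      ultimately show False using ne by (metis leading_coeff_0_iff)
    qed
    then show "f \<in> range (\<lambda>a. smult a P)" by auto
  next
    fix f assume "f \<in> range (\<lambda>a. smult a P)"
    moreover have "L (smult a P) = 0" for a
      using lin[of P "1 - a" P] P(2) by (simp add: smult_diff_left)
    ultimately show "f \<in> poly_solutions L" by (auto simp: poly_solutions_def)
  qed
  interpret vector_space "smult :: complex \<Rightarrow> complex poly \<Rightarrow> complex poly"
    by standard (simp_all add: smult_add_left smult_add_right)
  show "dim (poly_solutions L) = 1"
    unfolding line span_singleton[symmetric] dim_span using P(1)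
    by (simp add: dim_eq_card_independent)
qed

lemma degree_product_op_solution:
  fixes \<tau> :: real
  assumes "product_op p (of_nat n + of_real \<tau>) (of_real \<tau>) f = 0" "f \<noteq> 0" and nonint: "2 * \<tau> \<notin> \<int>"
  shows "degree f = n - 1"
proof -
  define d where "d = degree f"
  have "complex_of_real (((real d + 1)^2 - (real n + 2 * \<tau>)^2) * ((real d + 1)^2 - (real n)^2)) = 0"
    using degree_product_op_kernel[OF assms(1,2)] by (simp add: d_def algebra_simps)
  then have "((real d + 1)^2 - (real n + 2 * \<tau>)^2) * ((real d + 1)^2 - (real n)^2) = 0"
    by (simp only: of_real_eq_0_iff)
  then consider "(real d + 1)^2 = (real n + 2 * \<tau>)^2" | "(real d + 1)^2 = (real n)^2" by auto
  then show ?thesis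
  proof cases
    case 1
    then have "2 * \<tau> = real d + 1 - real n \<or> 2 * \<tau> = - (real d + 1) - real n"
      by (auto simp: power2_eq_iff)
    moreover have "real d + 1 - real n \<in> \<int>" "- (real d + 1) - real n \<in> \<int>" by simp_all
    ultimately show ?thesis using nonint by metis
  next
    case 2
    then have "real (d + 1) = real n" by (auto simp: power2_eq_iff)
    then show ?thesis unfolding d_def of_nat_eq_iff by simp
  qed
qed

section \<open>The differential system of a product\<close>

text \<open>
  The hypotheses are the first order system of \<open>A = \<phi> \<psi> / sin \<theta>\<close>, \<open>F = \<phi>' \<psi>\<close>,
  \<open>G = - \<phi> \<psi>'\<close>, \<open>K = - sin \<theta> \<phi>' \<psi>'\<close> for two normal form Gegenbauer equations with
  squared spectral parameters \<open>u\<close> and \<open>v\<close>; note that \<open>w \<partial>\<close> is \<open>- sin \<theta>\<close> times the derivative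
  in \<open>\<theta>\<close>.  The elimination becomes short through the intermediate quantity \<open>C = H A - (u + v) A\<close>, for
  which \<open>w C = 2 (K + l A)\<close>; a second application of \<open>H - (u + v)\<close> produces
  \<open>4 u v A - 4 l A''\<close>.
\<close>

lemma fourth_order_equation:
  fixes u v l A F G K :: "complex poly"
  defines "w \<equiv> 1 - cvar^2"
  assumes const: "pderiv u = 0" "pderiv v = 0" "pderiv l = 0"
    and A: "w * pderiv A = cvar * A - F + G"
    and F: "w * pderiv F = K + (u * w + l) * A"
    and G: "w * pderiv G = - K - (v * w + l) * A"
    and K: "w * pderiv K = - cvar * K + (u * w + l) * G - (v * w + l) * F"
  shows "cheb_op (cheb_op A) - 2 * (u + v) * cheb_op A + (u - v)^2 * A + 4 * l * pderiv (pderiv A) = 0"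
proof -
  define x where "x = cvar"
  have x: "pderiv x = 1" by (simp add: x_def pderiv_cvar)
  have w: "w = 1 - x^2" by (simp add: w_def x_def)
  have w': "pderiv w = - 2 * x" unfolding w_def x_def by (rule pderiv_one_minus_sq)
  have w0: "w \<noteq> 0"
    using w' by (auto simp: x_def)
  have cheb_op: "cheb_op f = - w * pderiv (pderiv f) + 3 * x * pderiv f + f" for f
    by (simp add: cheb_op_def w_def x_def algebra_simps)
  note A = A[folded x_def] and K = K[folded x_def]
  define C where "C = cheb_op A - (u + v) * A"
  have A2: "w * pderiv (pderiv A) - 2 * x * pderiv A = A + x * pderiv A - pderiv F + pderiv G"
    using arg_cong[OF A, of pderiv]
    by (simp add: pderiv_mult pderiv_add pderiv_diff w' x algebra_simps)
  have A2w: "w^2 * pderiv (pderiv A)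
      = w * A + 3 * x * (x * A - F + G) - 2 * K - ((u + v) * w + 2 * l) * A"
    using A2 A F G by algebra
  have C1: "w * C = 2 * (K + l * A)"
  proof -
    have "w * (w * C) = w * (2 * (K + l * A))"
      unfolding C_def cheb_op using A2w A w by algebra
    then show ?thesis using w0 by simp
  qed
  have D: "w * pderiv (K + l * A) = - x * K + l * x * A + (u * w + 2 * l) * G - (v * w + 2 * l) * F"
    using A K by (simp add: pderiv_add pderiv_mult const) algebra
  \<comment> \<open>The value of \<open>w\<^sup>2 C'\<close>, which has no denominator.\<close>
  define q where "q = 2 * (x * K + 3 * l * x * A + (u * w + 2 * l) * G - (v * w + 2 * l) * F)"
  have "w * pderiv C - 2 * x * C = 2 * pderiv (K + l * A)"
    using arg_cong[OF C1, of pderiv]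
    by (simp add: pderiv_mult pderiv_add pderiv_diff w' const pderiv_smult algebra_simps)
  then have C2: "w^2 * pderiv C = q"
    using D C1 unfolding q_def by algebra
  have q1: "w * pderiv q = 2 * ((w - x^2 - (u + v) * w - 4 * l) * K + x * (4 * l - u * w) * G
      + x * (v * w - 4 * l) * F
      + (3 * l - 2 * u * v * w^2 - 3 * l * (u + v) * w - 4 * l^2) * A)"
  proof -
    have "pderiv q = 2 * (K + x * pderiv K + 3 * l * A + 3 * l * x * pderiv A
       - 2 * u * x * G + (u * w + 2 * l) * pderiv G + 2 * v * x * F - (v * w + 2 * l) * pderiv F)"
      unfolding q_def
      by (simp add: pderiv_mult pderiv_add pderiv_diff w' x const pderiv_smult algebra_simps)
    then show ?thesis using A F G K w by algebra
  qed
  have "w^2 * pderiv (pderiv C) - 4 * x * w * pderiv C = pderiv q"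
    using arg_cong[OF C2, of pderiv]
    by (simp add: pderiv_mult power2_eq_square w' algebra_simps)
  moreover have "w^3 * pderiv (pderiv C)
      = w * (w^2 * pderiv (pderiv C) - 4 * x * w * pderiv C) + 4 * x * (w^2 * pderiv C)"
    by algebra
  ultimately have C3: "w^3 * pderiv (pderiv C) = w * pderiv q + 4 * x * q"
    using C2 by simp
  have "w * (w^2 * (cheb_op C - (u + v) * C)) = w * (w^2 * (4 * u * v * A - 4 * l * pderiv (pderiv A)))"
    unfolding cheb_op[of C] using A2w q1 q_def C1 C2 C3 w by algebra
  then have C4: "cheb_op C - (u + v) * C = 4 * u * v * A - 4 * l * pderiv (pderiv A)"
    using w0 by simp
  have "cheb_op C = cheb_op (cheb_op A) - (u + v) * cheb_op A"
  proof -
    have "pderiv C = pderiv (cheb_op A) - (u + v) * pderiv A"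
      unfolding C_def by (simp add: pderiv_diff pderiv_mult pderiv_add const)
    moreover have "pderiv (pderiv C) = pderiv (pderiv (cheb_op A)) - (u + v) * pderiv (pderiv A)"
      unfolding C_def by (simp add: pderiv_diff pderiv_mult pderiv_add const)
    ultimately show ?thesis
      unfolding cheb_op[of C] cheb_op[of "cheb_op A"] using C_def cheb_op[of A] by algebra
  qed
  then show ?thesis using C4 unfolding C_def by algebra
qed

section \<open>Ladder relations along the recurrence\<close>

text \<open>
  If \<open>A\<close> were a Gegenbauer function, \<open>w A' = - N c A + S a\<close> would hold with \<open>a\<close> its predecessor.
  For a general solution of the recurrence the defect \<open>E\<close> comes from differentiating the
  coefficients of the combination of Gegenbauer functions.  These do not depend on the index, so \<open>E\<close>
  again solves the recurrence, and both ladder relations move up by one step.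
\<close>

lemma ladder_step:
  fixes w x N S A a A' E e E' :: "complex poly"
  assumes const: "pderiv N = 0" "pderiv S = 0" and x: "pderiv x = 1"
    and w: "w = 1 - x^2" and N: "N + 1 \<noteq> 0"
    and A: "w * pderiv A = - N * x * A + S * a + E"
    and a: "w * pderiv a = S * x * a - N * A + e"
    and A': "(N + 1) * A' = (N + S + 1) * x * A - S * a"
    and E': "(N + 1) * E' = (N + S + 1) * x * E - S * e"
  shows "w * pderiv A' = - (N + 1) * x * A' + (S + 1) * A + E'"
    and "w * pderiv A = (S + 1) * x * A - (N + 1) * A' + E"
proof -
  show "w * pderiv A = (S + 1) * x * A - (N + 1) * A' + E"
    using A A' by algebra
  have "(N + 1) * pderiv A' = (N + S + 1) * (x * pderiv A + A) - S * pderiv a"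
    using arg_cong[OF A', of pderiv]
    by (simp add: pderiv_mult pderiv_add pderiv_diff const x algebra_simps)
  then have "(N + 1) * (w * pderiv A') = (N + 1) * (- (N + 1) * x * A' + (S + 1) * A + E')"
    using A a A' E' w by algebra
  then show "w * pderiv A' = - (N + 1) * x * A' + (S + 1) * A + E'"
    using N by simp
qed

text \<open>
  The combinations \<open>s x A - S a\<close> (in the index) and \<open>t x A + T B\<close> (in the initial data) each
  take the derivative of one of the two factors of the product, and \<open>K\<close> applies both.  In these terms
  the four ladder relations amount to the system required by \<open>fourth_order_equation\<close>.
\<close>

lemma ladder_imp_tensor_system:
  fixes w x s S t T p a A b B :: "complex poly"
  assumes const: "pderiv s = 0" "pderiv t = 0" "pderiv p = 0" and x: "pderiv x = 1"
    and w: "w = 1 - x^2" and S: "S = s + p - 1" and T: "T = t + 1 - p"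
    and A: "w * pderiv A = - (s - p) * x * A + S * a + T * (x * A + B)"
    and a: "w * pderiv a = S * x * a - (s - p) * A + T * (x * a + b)"
    and B: "w * pderiv B = - (s - p) * x * B + S * b - (t + p) * (A + x * B)"
    and b: "w * pderiv b = S * x * b - (s - p) * B - (t + p) * (a + x * b)"
    and F: "F = s * x * A - S * a" and G: "G = t * x * A + T * B"
    and K: "K = s * t * x^2 * A + s * x * T * B - S * t * x * a - S * T * b"
    and l: "l = p * (1 - p)"
  shows "w * pderiv A = x * A - F + G"
    and "w * pderiv F = K + (s^2 * w + l) * A"
    and "w * pderiv G = - K - (t^2 * w + l) * A"
    and "w * pderiv K = - x * K + (s^2 * w + l) * G - (t^2 * w + l) * F"
proof -
  have ST: "pderiv S = 0" "pderiv T = 0"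
    by (simp_all add: S T const pderiv_add pderiv_diff)
  note D = pderiv_mult pderiv_add pderiv_diff power2_eq_square const ST x algebra_simps
  show "w * pderiv A = x * A - F + G"
    using A F G S T by algebra
  have "pderiv F = s * A + s * x * pderiv A - S * pderiv a"
    unfolding F by (simp add: D)
  then show "w * pderiv F = K + (s^2 * w + l) * A"
    using A a K l w S T by algebra
  have "pderiv G = t * A + t * x * pderiv A + T * pderiv B"
    unfolding G by (simp add: D)
  then show "w * pderiv G = - K - (t^2 * w + l) * A"
    using A B K l w S T by algebra
  have "pderiv K = 2 * s * t * x * A + s * t * x^2 * pderiv A + s * T * B + s * x * T * pderiv B
      - S * t * a - S * t * x * pderiv a - S * T * pderiv b"
    unfolding K by (simp add: D)
  then show "w * pderiv K = - x * K + (s^2 * w + l) * G - (t^2 * w + l) * F"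
    using A a B b F G K l w S T by algebra
qed

section \<open>Associated Gegenbauer polynomials\<close>

text \<open>
  For \<open>t = p\<close> the index is the degree in the recurrence of the Gegenbauer polynomials of parameter
  \<open>p\<close>; in general the degree is shifted by \<open>t - p\<close>.  The initial values are left free since
  the ladder relations involve two independent solutions.
\<close>

fun assoc_gegenbauer ::
    "complex \<Rightarrow> complex \<Rightarrow> complex poly \<Rightarrow> complex poly \<Rightarrow> nat \<Rightarrow> complex poly" where
  "assoc_gegenbauer p t y0 y1 0 = y0"
| "assoc_gegenbauer p t y0 y1 (Suc 0) = y1"
| "assoc_gegenbauer p t y0 y1 (Suc (Suc n)) =
     smult (1 / (of_nat n + 2 + t - p))
       (smult (2 * (of_nat n + 1 + t)) (cvar * assoc_gegenbauer p t y0 y1 (Suc n))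
        - smult (of_nat n + t + p) (assoc_gegenbauer p t y0 y1 n))"

lemma assoc_gegenbauer_recurrence:
  assumes "of_nat n + 2 + t - p \<noteq> 0"
  shows "[:of_nat n + 2 + t - p:] * assoc_gegenbauer p t y0 y1 (Suc (Suc n))
    = [:2 * (of_nat n + 1 + t):] * cvar * assoc_gegenbauer p t y0 y1 (Suc n)
      - [:of_nat n + t + p:] * assoc_gegenbauer p t y0 y1 n"
  using assms by simp

text \<open>
  The defects of the two fundamental solutions are \<open>T (c A + B)\<close> and \<open>- (t + p) (A + c B)\<close>.
  Being solutions of the recurrence, they are determined by their two initial values, and these
  can be read off from the constant initial values of \<open>A\<close> and \<open>B\<close>.
\<close>

lemma assoc_gegenbauer_ladder:
  fixes t p :: complex and n :: nat
  defines "w \<equiv> 1 - cvar^2" and "T \<equiv> [:t + 1 - p:]" and "N \<equiv> [:of_nat n + 1 + t - p:]"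
    and "S \<equiv> [:of_nat n + t + p:]"
    and "A \<equiv> assoc_gegenbauer p t 0 1" and "B \<equiv> assoc_gegenbauer p t 1 0"
  assumes ok: "\<And>k. of_nat k + 2 + t - p \<noteq> 0"
  shows "w * pderiv (A (Suc n)) = - N * cvar * A (Suc n) + S * A n + T * (cvar * A (Suc n) + B (Suc n))"
    and "w * pderiv (A n) = S * cvar * A n - N * A (Suc n) + T * (cvar * A n + B n)"
    and "w * pderiv (B (Suc n)) = - N * cvar * B (Suc n) + S * B n
           - [:t + p:] * (A (Suc n) + cvar * B (Suc n))"
    and "w * pderiv (B n) = S * cvar * B n - N * B (Suc n) - [:t + p:] * (A n + cvar * B n)"
proof -
  define x where "x = cvar"
  define U where "U = [:t + p:]"
  define N' where "N' k = [:of_nat k + 1 + t - p:]" for k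
  define S' where "S' k = [:of_nat k + t + p:]" for k
  have x: "pderiv x = 1" by (simp add: x_def pderiv_cvar)
  have w: "w = 1 - x^2" by (simp add: w_def x_def)
  have "w * pderiv (A (Suc n)) = - N' n * x * A (Suc n) + S' n * A n + T * (x * A (Suc n) + B (Suc n)) \<and>
    w * pderiv (A n) = S' n * x * A n - N' n * A (Suc n) + T * (x * A n + B n) \<and>
    w * pderiv (B (Suc n)) = - N' n * x * B (Suc n) + S' n * B n - U * (A (Suc n) + x * B (Suc n)) \<and>
    w * pderiv (B n) = S' n * x * B n - N' n * B (Suc n) - U * (A n + x * B n)"
  proof (induction n)
    case 0
    show ?case
      by (simp add: A_def B_def N'_def S'_def T_def U_def x_def pderiv_pCons one_pCons)
  next
    case (Suc n)
    have const: "pderiv (N' n) = 0" "pderiv (S' n) = 0" by (simp_all add: N'_def S'_def pderiv_pCons)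
    have N2: "N' n + 1 = [:of_nat n + 2 + t - p:]" by (simp add: N'_def one_pCons)
    then have N0: "N' n + 1 \<noteq> 0" using ok[of n] by simp
    have N1: "N' n + 1 = N' (Suc n)" and S1: "S' n + 1 = S' (Suc n)"
      by (simp_all add: N'_def S'_def one_pCons)
    have rec: "(N' n + 1) * Y (Suc (Suc n)) = (N' n + S' n + 1) * x * Y (Suc n) - S' n * Y n"
      if "Y = A \<or> Y = B" for Y
    proof -
      have "N' n + S' n + 1 = [:2 * (of_nat n + 1 + t):]"
        by (simp_all add: N'_def S'_def one_pCons)
      then show ?thesis
        using that N2 assoc_gegenbauer_recurrence[OF ok, of n] unfolding A_def B_def S'_def x_def
        by metis
    qed
    note recA = rec[of A, simplified] and recB = rec[of B, simplified]
    \<comment> \<open>The defects solve the recurrence because their coefficients do not depend on the index.\<close>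
    have EA: "(N' n + 1) * (T * (x * A (Suc (Suc n)) + B (Suc (Suc n))))
        = (N' n + S' n + 1) * x * (T * (x * A (Suc n) + B (Suc n))) - S' n * (T * (x * A n + B n))"
      using recA recB by algebra
    have EB: "(N' n + 1) * (- (U * (A (Suc (Suc n)) + x * B (Suc (Suc n)))))
        = (N' n + S' n + 1) * x * (- (U * (A (Suc n) + x * B (Suc n)))) - S' n * (- (U * (A n + x * B n)))"
      using recA recB by algebra
    note step = ladder_step[OF const x w N0]
    show ?case
      using step[OF _ _ recA EA] step[OF _ _ recB EB] Suc.IH
      unfolding N1 S1 diff_conv_add_uminus by metis
  qed
  then show "w * pderiv (A (Suc n)) = - N * cvar * A (Suc n) + S * A n + T * (cvar * A (Suc n) + B (Suc n))"
    and "w * pderiv (A n) = S * cvar * A n - N * A (Suc n) + T * (cvar * A n + B n)"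
    and "w * pderiv (B (Suc n)) = - N * cvar * B (Suc n) + S * B n
           - [:t + p:] * (A (Suc n) + cvar * B (Suc n))"
    and "w * pderiv (B n) = S * cvar * B n - N * B (Suc n) - [:t + p:] * (A n + cvar * B n)"
    unfolding N'_def S'_def U_def x_def N_def S_def by blast+
qed

lemma product_op_assoc_gegenbauer:
  assumes ok: "\<And>k. of_nat k + 2 + t - p \<noteq> 0"
  shows "product_op p (of_nat n + t) t (assoc_gegenbauer p t 0 1 n) = 0"
proof (cases n)
  case 0
  then show ?thesis by (simp add: product_op_def cheb_op_def)
next
  case (Suc k)
  define s where "s = of_nat n + t"
  have N: "[:of_nat k + 1 + t - p:] = [:s:] - [:p:]" and S: "[:of_nat k + t + p:] = [:s:] + [:p:] - 1"
    and T: "[:t + 1 - p:] = [:t:] + 1 - [:p:]" and U: "[:t + p:] = [:t:] + [:p:]"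
    by (simp_all add: s_def Suc one_pCons)
  note lad = assoc_gegenbauer_ladder[OF ok, of k, unfolded N S T U]
  have "pderiv [:s:] = 0" "pderiv [:t:] = 0" "pderiv [:p:] = 0" by (simp_all add: pderiv_pCons)
  note sys = ladder_imp_tensor_system[OF this pderiv_cvar refl refl refl lad refl refl refl refl]
  have "cheb_op (cheb_op (assoc_gegenbauer p t 0 1 (Suc k)))
      - 2 * ([:s:]^2 + [:t:]^2) * cheb_op (assoc_gegenbauer p t 0 1 (Suc k))
      + ([:s:]^2 - [:t:]^2)^2 * assoc_gegenbauer p t 0 1 (Suc k)
      + 4 * ([:p:] * (1 - [:p:])) * pderiv (pderiv (assoc_gegenbauer p t 0 1 (Suc k))) = 0"
    by (rule fourth_order_equation[OF _ _ _ sys])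
      (simp_all add: power2_eq_square pderiv_mult pderiv_diff pderiv_smult pderiv_pCons)
  moreover have sm: "smult a q = [:a:] * q" for a :: complex and q by simp
  moreover have "2 * ([:s:]^2 + [:t:]^2) = [:2 * (s^2 + t^2):]" "([:s:]^2 - [:t:]^2)^2 = [:(s^2 - t^2)^2:]"
    "4 * ([:p:] * (1 - [:p:])) = [:4 * p * (1 - p):]"
    by (simp_all add: power2_eq_square one_pCons numeral_poly)
  ultimately show ?thesis
    unfolding product_op_def s_def[symmetric] unfolding Suc sm by (simp only:)
qed

lemma assoc_gegenbauer_unique:
  assumes rec: "\<And>n. [:of_nat n + 2 + t - p:] * Y (Suc (Suc n))
      = [:2 * (of_nat n + 1 + t):] * cvar * Y (Suc n) - [:of_nat n + t + p:] * Y n"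
    and ok: "\<And>k. of_nat k + 2 + t - p \<noteq> 0" and Y: "Y 0 = 0" "Y (Suc 0) = [:a:]"
  shows "Y n = smult a (assoc_gegenbauer p t 0 1 n)"
proof (induction n rule: induct_nat_012)
  case 0
  then show ?case using Y by simp
next
  case 1
  then show ?case using Y by (simp add: one_pCons)
next
  case (ge2 n)
  have "[:of_nat n + 2 + t - p:] * Y (Suc (Suc n))
     = [:of_nat n + 2 + t - p:] * ([:a:] * assoc_gegenbauer p t 0 1 (Suc (Suc n)))"
  proof -
    have "Y (Suc n) = [:a:] * assoc_gegenbauer p t 0 1 (Suc n)" "Y n = [:a:] * assoc_gegenbauer p t 0 1 n"
      using ge2 by simp_all
    then show ?thesis
      using rec[of n] assoc_gegenbauer_recurrence[OF ok[of n], of 0 1] by algebra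
  qed
  moreover have "[:of_nat n + 2 + t - p:] \<noteq> 0" using ok[of n] by simp
  ultimately have "Y (Suc (Suc n)) = [:a:] * assoc_gegenbauer p t 0 1 (Suc (Suc n))"
    using mult_left_cancel by blast
  then show ?case by simp
qed

text \<open>
  Each step multiplies the leading coefficient by \<open>2 (n + 1 + t) / (n + 2 + t - p)\<close>, so the degree
  grows by exactly one.
\<close>

lemma assoc_gegenbauer_nonzero:
  assumes ok: "\<And>k. of_nat k + 2 + t - p \<noteq> 0" and ok2: "\<And>k. of_nat k + 1 + t \<noteq> 0"
  shows "assoc_gegenbauer p t 0 1 (Suc n) \<noteq> 0"
proof -
  define A where "A = assoc_gegenbauer p t 0 1"
  have "(\<forall>k\<ge>n. coeff (A n) k = 0) \<and> (\<forall>k>n. coeff (A (Suc n)) k = 0) \<and> coeff (A (Suc n)) n \<noteq> 0"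
  proof (induction n)
    case 0
    then show ?case by (auto simp: A_def coeff_pCons split: nat.split)
  next
    case (Suc n)
    have "A (Suc (Suc n)) = smult (1 / (of_nat n + 2 + t - p))
        (smult (2 * (of_nat n + 1 + t)) (pCons 0 (A (Suc n))) - smult (of_nat n + t + p) (A n))"
      by (simp add: A_def)
    then have "coeff (A (Suc (Suc n))) (Suc k) = 1 / (of_nat n + 2 + t - p)
        * (2 * (of_nat n + 1 + t) * coeff (A (Suc n)) k - (of_nat n + t + p) * coeff (A n) (Suc k))" for k
      by (simp only: coeff_smult coeff_diff coeff_pCons_Suc)
    moreover have "coeff (A n) (Suc k) = 0" if "k \<ge> n" for k
      using Suc.IH that by simp
    ultimately have rec: "coeff (A (Suc (Suc n))) (Suc k)
        = 2 * (of_nat n + 1 + t) / (of_nat n + 2 + t - p) * coeff (A (Suc n)) k" if "k \<ge> n" for k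
      using that by simp
    have "coeff (A (Suc (Suc n))) k = 0" if "k > Suc n" for k
      using that rec[of "k - 1"] Suc.IH by (cases k) auto
    moreover have "2 * (of_nat n + 1 + t) \<noteq> 0"
      using ok2[of n] by (simp only: mult_eq_0_iff) simp
    then have "coeff (A (Suc (Suc n))) (Suc n) \<noteq> 0"
      using rec[of n] Suc.IH ok[of n] by (simp only: mult_eq_0_iff divide_eq_0_iff) simp
    ultimately show ?case using Suc.IH by (auto simp: Suc_le_eq)
  qed
  then show ?thesis unfolding A_def by auto
qed

section \<open>The recurrence along multiples of r\<close>

text \<open>
  The offset \<open>h\<close> is the position of the zero initial value: \<open>h = 0\<close> for the type 2
  family, \<open>h = 1\<close> for the type 1 family.  Starting the sequence later by \<open>h\<close> raises \<open>t\<close> by \<open>h\<close>.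
\<close>

lemma rec_solution_assoc_gegenbauer:
  fixes r m :: int and h :: nat
  assumes r: "r \<ge> 2" and m: "m \<ge> 2" and P: "satisfies_recurrence r m P"
    and t: "t = 1 / of_int r + 1 / of_int m - 2 + of_nat h"
    and h: "P (r * int h - 2 * r) = 0" "P (r * (int h + 1) - 2 * r) = [:a:]"
    and ok: "\<And>k. of_nat k + 2 + t + 1 / of_int m \<noteq> 0"
  shows "P (r * int (n + h) - 2 * r) = smult a (assoc_gegenbauer (- 1 / of_int m) t 0 1 n)"
proof -
  define Y where "Y n = P (r * int (n + h) - 2 * r)" for n
  have "Y n = smult a (assoc_gegenbauer (- 1 / of_int m) t 0 1 n)"
  proof (rule assoc_gegenbauer_unique)
    fix n
    define k where "k = r * int (n + h)"
    define R M :: complex where "R = of_int r" and "M = of_int m"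
    have RM: "R \<noteq> 0" "M \<noteq> 0" using r m by (auto simp: R_def M_def)
    have "k \<ge> 0" using r by (simp add: k_def)
    then have "of_int (2*r + m + k*m) * P k =
        2 * cvar * of_int (r + (1 + k - r)*m) * P (k - r) - of_int ((k - (2*r - 1)) * m) * P (k - 2*r)"
      using P by (simp add: satisfies_recurrence_def)
    moreover have "2 * cvar * of_int c * q = smult (2 * of_int c) (cvar * q)" for c and q :: "complex poly"
      by (simp add: of_int_poly numeral_poly mult.commute)
    ultimately have "smult (of_int (2*r + m + k*m)) (P k) =
        smult (2 * of_int (r + (1 + k - r)*m)) (cvar * P (k - r))
        - smult (of_int ((k - (2*r - 1)) * m)) (P (k - 2*r))"
      by (simp only: of_int_mult_poly)
    moreover have "P k = Y (Suc (Suc n))" "P (k - r) = Y (Suc n)" "P (k - 2 * r) = Y n"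
      by (simp_all add: Y_def k_def algebra_simps)
    moreover have "(of_int (2*r + m + k*m) :: complex) = M * R * (of_nat n + 2 + t - (- 1 / M))"
      "(of_int (r + (1 + k - r)*m) :: complex) = M * R * (of_nat n + 1 + t)"
      "(of_int ((k - (2*r - 1)) * m) :: complex) = M * R * (of_nat n + t + (- 1 / M))"
      using RM by (simp_all add: k_def t R_def[symmetric] M_def[symmetric] field_simps)
    ultimately have "smult (M * R) ([:of_nat n + 2 + t - (- 1 / M):] * Y (Suc (Suc n)))
      = smult (M * R) ([:2 * (of_nat n + 1 + t):] * cvar * Y (Suc n) - [:of_nat n + t + (- 1 / M):] * Y n)"
      by (simp only:) (simp add: smult_diff_right algebra_simps)
    then show "[:of_nat n + 2 + t - (- 1 / of_int m):] * Y (Suc (Suc n))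
      = [:2 * (of_nat n + 1 + t):] * cvar * Y (Suc n) - [:of_nat n + t + (- 1 / of_int m):] * Y n"
      using RM unfolding M_def by (metis mult_eq_0_iff smult_cancel)
  qed (use ok h in \<open>simp_all add: Y_def add.commute\<close>)
  then show ?thesis by (simp add: Y_def)
qed

section \<open>Identification of the two operators\<close>

text \<open>
  Expanding \<open>H\<^sup>2\<close> gives
  \[ (c^2 - 1)^2 \partial^4 + 10 c (c^2 - 1) \partial^3 + (25 c^2 - 10) \partial^2 + 15 c \partial + 1 , \]
  which explains the numbers in the hypotheses.
\<close>

lemma diff_op_eq_product_op:
  fixes s t p :: complex
  assumes X: "of_int X = of_int (m^2 * r^4) * (25 - 2 * (s^2 + t^2))"
    and Y: "of_int Y = of_int (m^2 * r^4) * (2 * (s^2 + t^2) - 10 + 4 * p * (1 - p))"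
    and Z: "of_int Z = of_int (m^2 * r^4) * (15 - 6 * (s^2 + t^2))"
    and W: "of_int W = of_int (m^2 * r^4) * (1 - 2 * (s^2 + t^2) + (s^2 - t^2)^2)"
  shows "diff_op r m X Y Z W f = smult (of_int (m^2 * r^4)) (product_op p s t f)"
proof -
  define M :: complex where "M = of_int (m^2 * r^4)"
  define x where "x = cvar"
  have x: "pderiv x = 1" by (simp add: x_def pderiv_cvar)
  define c where "c a = [:a:]" for a :: complex
  have c1: "c 1 = 1" and cm: "c (a * b) = c a * c b" for a b
    by (simp_all add: c_def one_pCons)
  have "c (a^k) = c a ^ k" for a k
    by (induction k) (simp_all add: c1 cm)
  then have c: "c (a + b) = c a + c b" "c (a - b) = c a - c b" "c (a * b) = c a * c b" "c (a^k) = c a ^ k"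
      "c 1 = 1" "c (numeral n) = numeral n" for a b k n
    by (simp_all add: c_def one_pCons numeral_poly)
  have i: "of_int a = c (of_int a)" for a by (simp add: c_def of_int_poly)
  have sm: "smult a q = c a * q" for a q by (simp add: c_def)
  have pd: "(pderiv ^^ 4) f = pderiv (pderiv (pderiv (pderiv f)))"
    "(pderiv ^^ 3) f = pderiv (pderiv (pderiv f))" "(pderiv ^^ 2) f = pderiv (pderiv f)"
    by (simp_all add: numeral_eq_Suc)
  have "pderiv (3 :: complex poly) = 0" by (simp add: numeral_poly pderiv_pCons)
  then have uu: "cheb_op (cheb_op f) = (x^2 - 1)^2 * pderiv (pderiv (pderiv (pderiv f)))
      + 10 * x * (x^2 - 1) * pderiv (pderiv (pderiv f)) + (25 * x^2 - 10) * pderiv (pderiv f)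
      + 15 * x * pderiv f + f"
    unfolding cheb_op_def x_def[symmetric]
    by (simp add: pderiv_mult pderiv_add pderiv_diff x power2_eq_square pderiv_smult algebra_simps)
  have u: "cheb_op f = (x^2 - 1) * pderiv (pderiv f) + 3 * x * pderiv f + f"
    by (simp add: cheb_op_def x_def)
  have M10: "of_int (10 * m^2 * r^4) = 10 * M" by (simp add: M_def)
  show ?thesis
    unfolding diff_op_def product_op_def pd uu x_def[symmetric]
    unfolding u sm i X Y Z W M10 M_def[symmetric] c by algebra
qed

text \<open>
  All coefficients are polynomials in \<open>r\<close>, \<open>m\<close>, \<open>j\<close>, while \<open>s\<close>, \<open>t\<close> and \<open>p\<close> have
  denominators.  The comparison is made through \<open>Q = m r t\<close> and the three combinations
  \<open>s\<^sup>2 + t\<^sup>2\<close>, \<open>(s\<^sup>2 - t\<^sup>2)\<^sup>2\<close>, \<open>p (1 - p)\<close>, which \<open>m\<^sup>2 r\<^sup>4\<close> makes polynomial.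
\<close>

lemma L2_eq_product_op:
  assumes "r \<noteq> 0" "m \<noteq> 0" and t: "t = 1 / of_int r + 1 / of_int m - 2"
  shows "L2 r m (r * j) f = smult (of_int (m^2 * r^4)) (product_op (- 1 / of_int m) (of_int j + t) t f)"
proof -
  define R M J \<mu> s :: complex
    where "R = of_int r" and "M = of_int m" and "J = of_int j" and "\<mu> = 1 / of_int m" and "s = of_int j + t"
  define Q where "Q = M + R - 2 * M * R"
  note of_int_hom = of_int_add of_int_diff of_int_minus of_int_mult of_int_power of_int_numeral of_int_1
    R_def[symmetric] M_def[symmetric] J_def[symmetric]
  have K: "of_int (m^2 * r^4) = M^2 * R^4" unfolding of_int_hom ..
  have s: "s = J + t" by (simp add: s_def J_def)
  have \<mu>: "M * \<mu> = 1" and MRt: "M * R * t = Q"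
    using assms(1,2) by (simp_all add: t R_def M_def \<mu>_def Q_def field_simps)
  have sum: "M^2 * R^4 * (s^2 + t^2) = R^2 * ((M * R * J + Q)^2 + Q^2)"
    unfolding MRt[symmetric] s by algebra
  have diff: "M^2 * R^4 * (s^2 - t^2)^2 = R^2 * J^2 * (M * R * J + 2 * Q)^2"
    unfolding MRt[symmetric] s by algebra
  have par: "M^2 * R^4 * (- \<mu> * (1 - - \<mu>)) = - (R^4 * (M + 1))"
    using \<mu> by algebra
  have X: "of_int (X2 r m (r * j)) = of_int (m^2 * r^4) * (25 - 2 * (s^2 + t^2))"
  proof -
    have "M^2 * R^4 * (25 - 2 * (s^2 + t^2)) = 25 * (M^2 * R^4) - 2 * (M^2 * R^4 * (s^2 + t^2))"
      by algebra
    also have "\<dots> = of_int (X2 r m (r * j))"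
      unfolding sum unfolding Q_def X2_def Delta_def of_int_hom by algebra
    finally show ?thesis unfolding K by (rule sym)
  qed
  have Y: "of_int (Y2 r m (r * j)) = of_int (m^2 * r^4) * (2 * (s^2 + t^2) - 10 + 4 * - \<mu> * (1 - - \<mu>))"
  proof -
    have "M^2 * R^4 * (2 * (s^2 + t^2) - 10 + 4 * - \<mu> * (1 - - \<mu>)) = 2 * (M^2 * R^4 * (s^2 + t^2)) - 10 * (M^2 * R^4) + 4 * (M^2 * R^4 * (- \<mu> * (1 - - \<mu>)))"
      by algebra
    also have "\<dots> = of_int (Y2 r m (r * j))"
      unfolding sum par unfolding Q_def Y2_def Delta_def of_int_hom by algebra
    finally show ?thesis unfolding K by (rule sym)
  qed
  have Z: "of_int (Z2 r m (r * j)) = of_int (m^2 * r^4) * (15 - 6 * (s^2 + t^2))"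
  proof -
    have "M^2 * R^4 * (15 - 6 * (s^2 + t^2)) = 15 * (M^2 * R^4) - 6 * (M^2 * R^4 * (s^2 + t^2))"
      by algebra
    also have "\<dots> = of_int (Z2 r m (r * j))"
      unfolding sum unfolding Q_def Z2_def Delta_def of_int_hom by algebra
    finally show ?thesis unfolding K by (rule sym)
  qed
  have W: "of_int (W2 r m (r * j)) = of_int (m^2 * r^4) * (1 - 2 * (s^2 + t^2) + (s^2 - t^2)^2)"
  proof -
    have "M^2 * R^4 * (1 - 2 * (s^2 + t^2) + (s^2 - t^2)^2) = M^2 * R^4 - 2 * (M^2 * R^4 * (s^2 + t^2)) + M^2 * R^4 * (s^2 - t^2)^2"
      by algebra
    also have "\<dots> = of_int (W2 r m (r * j))"
      unfolding sum diff unfolding Q_def W2_def Delta_def of_int_hom by algebra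
    finally show ?thesis unfolding K by (rule sym)
  qed
  show ?thesis
    using diff_op_eq_product_op[OF X Y Z W] unfolding L2_def by (simp add: \<mu>_def s_def)
qed

text \<open>
  The type 1 sequence starts one step later: with \<open>n = r (j + 1)\<close>, the index is \<open>j\<close> and \<open>t\<close> is
  larger by one than for type 2.
\<close>

lemma L1_eq_product_op:
  assumes "r \<noteq> 0" "m \<noteq> 0" and t: "t = 1 / of_int r + 1 / of_int m - 1"
  shows "L1 r m (r * (j + 1)) f = smult (of_int (m^2 * r^4)) (product_op (- 1 / of_int m) (of_int j + t) t f)"
proof -
  define R M J \<mu> s :: complex
    where "R = of_int r" and "M = of_int m" and "J = of_int j" and "\<mu> = 1 / of_int m" and "s = of_int j + t"
  define Q where "Q = M + R - M * R"
  note of_int_hom = of_int_add of_int_diff of_int_minus of_int_mult of_int_power of_int_numeral of_int_1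
    R_def[symmetric] M_def[symmetric] J_def[symmetric]
  have K: "of_int (m^2 * r^4) = M^2 * R^4" unfolding of_int_hom ..
  have s: "s = J + t" by (simp add: s_def J_def)
  have \<mu>: "M * \<mu> = 1" and MRt: "M * R * t = Q"
    using assms(1,2) by (simp_all add: t R_def M_def \<mu>_def Q_def field_simps)
  have sum: "M^2 * R^4 * (s^2 + t^2) = R^2 * ((M * R * J + Q)^2 + Q^2)"
    unfolding MRt[symmetric] s by algebra
  have diff: "M^2 * R^4 * (s^2 - t^2)^2 = R^2 * J^2 * (M * R * J + 2 * Q)^2"
    unfolding MRt[symmetric] s by algebra
  have par: "M^2 * R^4 * (- \<mu> * (1 - - \<mu>)) = - (R^4 * (M + 1))"
    using \<mu> by algebra
  have X: "of_int (X1 r m (r * (j + 1))) = of_int (m^2 * r^4) * (25 - 2 * (s^2 + t^2))"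
  proof -
    have "M^2 * R^4 * (25 - 2 * (s^2 + t^2)) = 25 * (M^2 * R^4) - 2 * (M^2 * R^4 * (s^2 + t^2))"
      by algebra
    also have "\<dots> = of_int (X1 r m (r * (j + 1)))"
      unfolding sum unfolding Q_def X1_def of_int_hom by algebra
    finally show ?thesis unfolding K by (rule sym)
  qed
  have Y: "of_int (Y1 r m (r * (j + 1))) = of_int (m^2 * r^4) * (2 * (s^2 + t^2) - 10 + 4 * - \<mu> * (1 - - \<mu>))"
  proof -
    have "M^2 * R^4 * (2 * (s^2 + t^2) - 10 + 4 * - \<mu> * (1 - - \<mu>)) = 2 * (M^2 * R^4 * (s^2 + t^2)) - 10 * (M^2 * R^4) + 4 * (M^2 * R^4 * (- \<mu> * (1 - - \<mu>)))"
      by algebra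
    also have "\<dots> = of_int (Y1 r m (r * (j + 1)))"
      unfolding sum par unfolding Q_def Y1_def of_int_hom by algebra
    finally show ?thesis unfolding K by (rule sym)
  qed
  have Z: "of_int (Z1 r m (r * (j + 1))) = of_int (m^2 * r^4) * (15 - 6 * (s^2 + t^2))"
  proof -
    have "M^2 * R^4 * (15 - 6 * (s^2 + t^2)) = 15 * (M^2 * R^4) - 6 * (M^2 * R^4 * (s^2 + t^2))"
      by algebra
    also have "\<dots> = of_int (Z1 r m (r * (j + 1)))"
      unfolding sum unfolding Q_def Z1_def of_int_hom by algebra
    finally show ?thesis unfolding K by (rule sym)
  qed
  have W: "of_int (W1 r m (r * (j + 1))) = of_int (m^2 * r^4) * (1 - 2 * (s^2 + t^2) + (s^2 - t^2)^2)"
  proof -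
    have "M^2 * R^4 * (1 - 2 * (s^2 + t^2) + (s^2 - t^2)^2) = M^2 * R^4 - 2 * (M^2 * R^4 * (s^2 + t^2)) + M^2 * R^4 * (s^2 - t^2)^2"
      by algebra
    also have "\<dots> = of_int (W1 r m (r * (j + 1)))"
      unfolding sum diff unfolding Q_def W1_def of_int_hom by algebra
    finally show ?thesis unfolding K by (rule sym)
  qed
  show ?thesis
    using diff_op_eq_product_op[OF X Y Z W] unfolding L1_def by (simp add: \<mu>_def s_def)
qed

section \<open>Solutions of both equations\<close>

lemma product_op_solution_line:
  fixes \<tau> :: real and n :: nat
  assumes L: "\<And>f. L f = smult M (product_op p (of_nat n + of_real \<tau>) (of_real \<tau>) f)" and M: "M \<noteq> 0"
    and P: "P = smult a (assoc_gegenbauer p (of_real \<tau>) 0 1 n)" and a: "a \<noteq> 0" and n: "n > 0"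
    and ok: "\<And>k. of_nat k + 2 + of_real \<tau> - p \<noteq> 0" and ok2: "\<And>k. of_nat k + 1 + \<tau> \<noteq> 0"
  shows "P \<noteq> 0" and "P \<in> poly_solutions L"
    and "2 * \<tau> \<notin> \<int> \<Longrightarrow> poly_solutions L = range (\<lambda>a. smult a P)"
    and "2 * \<tau> \<notin> \<int> \<Longrightarrow> vector_space.dim smult (poly_solutions L) = 1"
proof -
  have ok2': "of_nat k + 1 + complex_of_real \<tau> \<noteq> 0" for k
  proof -
    have "of_nat k + 1 + complex_of_real \<tau> = of_real (of_nat k + 1 + \<tau>)" by simp
    then show ?thesis using ok2[of k] of_real_eq_0_iff by metis
  qed
  show P0: "P \<noteq> 0"
    using assoc_gegenbauer_nonzero[OF ok ok2', of "n - 1"] n a P by simp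
  have lin: "L (f - smult c g) = L f - smult c (L g)" for f g c
    by (simp add: L product_op_diff_smult smult_diff_right mult.commute)
  have "L (0 - smult (- a) (assoc_gegenbauer p (of_real \<tau>) 0 1 n)) = 0"
    unfolding L product_op_diff_smult product_op_assoc_gegenbauer[OF ok]
    by (simp add: product_op_def cheb_op_def)
  then have LP: "L P = 0" by (simp add: P)
  then show "P \<in> poly_solutions L" by (simp add: poly_solutions_def)
  assume nonint: "2 * \<tau> \<notin> \<int>"
  have "degree f = n - 1" if "L f = 0" "f \<noteq> 0" for f
    using degree_product_op_solution[OF _ that(2) nonint] that(1) M L by simp
  from poly_solutions_line[of L P, OF lin P0 LP this]
  show "poly_solutions L = range (\<lambda>a. smult a P)" "vector_space.dim smult (poly_solutions L) = 1"
    by blast+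
qed

lemma reciprocal_sum_facts:
  fixes r m :: int
  assumes r: "r \<ge> 2" and m: "m \<ge> 4"
  defines "\<tau> \<equiv> 1 / real_of_int r + 1 / real_of_int m"
  shows "0 < \<tau>" "\<tau> < 1" and "\<tau> \<noteq> 1 / 2 \<Longrightarrow> 2 * \<tau> \<notin> \<int>"
    and "of_nat k + of_real \<tau> + 1 / of_int m \<noteq> (0 :: complex)"
proof -
  have "1 / real_of_int r \<le> 1 / 2" "1 / real_of_int m \<le> 1 / 4"
    using r m by (intro divide_left_mono; simp)+
  moreover have pos: "0 < 1 / real_of_int r" "0 < 1 / real_of_int m" using r m by simp_all
  ultimately show b: "0 < \<tau>" "\<tau> < 1" unfolding \<tau>_def by linarith+
  show "2 * \<tau> \<notin> \<int>" if "\<tau> \<noteq> 1 / 2"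
  proof
    assume "2 * \<tau> \<in> \<int>"
    then obtain z where z: "2 * \<tau> = of_int z" by (elim Ints_cases)
    then have "0 < z" "z < 2" using b by linarith+
    then have "z = 1" by simp
    then show False using z that by simp
  qed
  have "of_nat k + of_real \<tau> + 1 / of_int m = complex_of_real (real k + \<tau> + 1 / real_of_int m)" by simp
  moreover have "real k + \<tau> + 1 / real_of_int m \<noteq> 0" using b pos by linarith
  ultimately show "of_nat k + of_real \<tau> + 1 / of_int m \<noteq> (0 :: complex)"
    using of_real_eq_0_iff by metis
qed

lemma type2_solution:
  fixes r m j :: int
  assumes r: "r \<ge> 2" and m: "m \<ge> 4" and j: "j > 0"
  shows "type2 r m (r * j - 2 * r) \<noteq> 0"
    and "type2 r m (r * j - 2 * r) \<in> poly_solutions (L2 r m (r * j))"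
    and "1 / real_of_int r + 1 / real_of_int m \<noteq> 1 / 2 \<Longrightarrow>
      poly_solutions (L2 r m (r * j)) = range (\<lambda>a. smult a (type2 r m (r * j - 2 * r)))"
    and "1 / real_of_int r + 1 / real_of_int m \<noteq> 1 / 2 \<Longrightarrow>
      vector_space.dim smult (poly_solutions (L2 r m (r * j))) = 1"
proof -
  note facts = reciprocal_sum_facts[OF r m]
  define \<tau> where "\<tau> = 1 / real_of_int r + 1 / real_of_int m - 2"
  obtain n where n: "j = int n" using j by (metis less_imp_le nonneg_int_cases)
  have ok: "of_nat k + 2 + complex_of_real \<tau> + 1 / of_int m \<noteq> 0" for k
    using facts(4)[of k] by (simp add: \<tau>_def)
  have "type2 r m (r * int (n + 0) - 2 * r) = smult 1 (assoc_gegenbauer (- 1 / of_int m) \<tau> 0 1 n)"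
    using r m ok unfolding type2_def
    by (intro rec_solution_assoc_gegenbauer rec_solution_satisfies_recurrence)
      (simp_all add: \<tau>_def rec_solution_neg one_pCons)
  then have P: "type2 r m (r * j - 2 * r) = smult 1 (assoc_gegenbauer (- 1 / of_int m) \<tau> 0 1 n)"
    by (simp add: n)
  have L: "L2 r m (r * j) f
      = smult (of_int (m^2 * r^4)) (product_op (- 1 / of_int m) (of_nat n + of_real \<tau>) (of_real \<tau>) f)" for f
    using r m L2_eq_product_op[of r m "of_real \<tau>" j f] by (simp add: \<tau>_def n)
  have ok': "of_nat k + 2 + complex_of_real \<tau> - (- 1 / of_int m) \<noteq> 0" "of_nat k + 1 + \<tau> \<noteq> 0" for k
    using ok[of k] facts(1,2) by (simp, cases k, auto simp: \<tau>_def)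
  have M: "(of_int (m^2 * r^4) :: complex) \<noteq> 0" using r m by simp
  have "n > 0" using j n by simp
  note sol = product_op_solution_line[OF L M P one_neq_zero this ok']
  show "type2 r m (r * j - 2 * r) \<noteq> 0" and "type2 r m (r * j - 2 * r) \<in> poly_solutions (L2 r m (r * j))"
    by (fact sol)+
  assume "1 / real_of_int r + 1 / real_of_int m \<noteq> 1 / 2"
  then have "2 * \<tau> + 4 \<notin> \<int>" using facts(3) by (simp add: \<tau>_def)
  then have "2 * \<tau> \<notin> \<int>" using Ints_add[of "2 * \<tau>" 4] by auto
  from sol(3,4)[OF this]
  show "poly_solutions (L2 r m (r * j)) = range (\<lambda>a. smult a (type2 r m (r * j - 2 * r)))"
    "vector_space.dim smult (poly_solutions (L2 r m (r * j))) = 1" .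
qed

text \<open>
  The type 1 sequence at the indices \<open>-2 r\<close>, \<open>-r\<close>, \<open>0\<close> has the values \<open>1\<close>, \<open>0\<close>, \<open>a\<close> with
  \<open>a = (2 r - 1) m / (2 r + m)\<close>; from the second one on, it is \<open>a\<close> times the associated
  Gegenbauer sequence with the larger shift.
\<close>

lemma type1_solution:
  fixes r m j :: int
  assumes r: "r \<ge> 2" and m: "m \<ge> 4" and j: "j > 0"
  shows "type1 r m (r * (j + 1) - 2 * r) \<noteq> 0"
    and "type1 r m (r * (j + 1) - 2 * r) \<in> poly_solutions (L1 r m (r * (j + 1)))"
    and "1 / real_of_int r + 1 / real_of_int m \<noteq> 1 / 2 \<Longrightarrow>
      poly_solutions (L1 r m (r * (j + 1))) = range (\<lambda>a. smult a (type1 r m (r * (j + 1) - 2 * r)))"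
    and "1 / real_of_int r + 1 / real_of_int m \<noteq> 1 / 2 \<Longrightarrow>
      vector_space.dim smult (poly_solutions (L1 r m (r * (j + 1)))) = 1"
proof -
  note facts = reciprocal_sum_facts[OF r m]
  define \<tau> where "\<tau> = 1 / real_of_int r + 1 / real_of_int m - 1"
  define a :: complex where "a = of_int ((2 * r - 1) * m) / of_int (2 * r + m)"
  obtain n where n: "j = int n" using j by (metis less_imp_le nonneg_int_cases)
  have ok: "of_nat k + 2 + complex_of_real \<tau> + 1 / of_int m \<noteq> 0" for k
    using facts(4)[of "Suc k"] by (simp add: \<tau>_def algebra_simps)
  have "type1 r m 0 = [:a:]"
    unfolding type1_def using r m
    by (subst rec_solution.simps) (simp add: rec_solution_neg a_def of_int_poly one_pCons left_diff_distrib diff_divide_distrib)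
  then have "type1 r m (r * int (n + 1) - 2 * r) = smult a (assoc_gegenbauer (- 1 / of_int m) \<tau> 0 1 n)"
    using r m ok
    by (intro rec_solution_assoc_gegenbauer)
      (simp_all add: \<tau>_def type1_def rec_solution_neg rec_solution_satisfies_recurrence)
  then have P: "type1 r m (r * (j + 1) - 2 * r) = smult a (assoc_gegenbauer (- 1 / of_int m) \<tau> 0 1 n)"
    by (simp add: n add.commute)
  have L: "L1 r m (r * (j + 1)) f
      = smult (of_int (m^2 * r^4)) (product_op (- 1 / of_int m) (of_nat n + of_real \<tau>) (of_real \<tau>) f)" for f
    using r m L1_eq_product_op[of r m "of_real \<tau>" j f] by (simp add: \<tau>_def n)
  have ok': "of_nat k + 2 + complex_of_real \<tau> - (- 1 / of_int m) \<noteq> 0" "of_nat k + 1 + \<tau> \<noteq> 0" for k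
    using ok[of k] facts(1,2) by (simp, auto simp: \<tau>_def)
  have M: "(of_int (m^2 * r^4) :: complex) \<noteq> 0" using r m by simp
  have "(of_int ((2 * r - 1) * m) :: complex) \<noteq> 0" "(of_int (2 * r + m) :: complex) \<noteq> 0"
    using r m unfolding of_int_eq_0_iff by auto
  then have a: "a \<noteq> 0" unfolding a_def divide_eq_0_iff by blast
  have "n > 0" using j n by simp
  note sol = product_op_solution_line[OF L M P a this ok']
  show "type1 r m (r * (j + 1) - 2 * r) \<noteq> 0"
    and "type1 r m (r * (j + 1) - 2 * r) \<in> poly_solutions (L1 r m (r * (j + 1)))"
    by (fact sol)+
  assume "1 / real_of_int r + 1 / real_of_int m \<noteq> 1 / 2"
  then have "2 * \<tau> + 2 \<notin> \<int>" using facts(3) by (simp add: \<tau>_def)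
  then have "2 * \<tau> \<notin> \<int>" using Ints_add[of "2 * \<tau>" 2] by auto
  from sol(3,4)[OF this]
  show "poly_solutions (L1 r m (r * (j + 1))) = range (\<lambda>a. smult a (type1 r m (r * (j + 1) - 2 * r)))"
    "vector_space.dim smult (poly_solutions (L1 r m (r * (j + 1)))) = 1" .
qed

theorem theorem3p9:
  fixes m :: int
  assumes "m \<ge> 4"
  shows
    "(\<forall>r n :: int.
        r \<ge> 2 \<longrightarrow> 1 / real_of_int r + 1 / real_of_int m \<noteq> 1 / 2 \<longrightarrow>
        n \<in> {r * j | j. j > 0} \<longrightarrow> n \<ge> 2*r \<longrightarrow>
          type1 r m (n - 2*r) \<noteq> 0 \<and>
          type1 r m (n - 2*r) \<in> poly_solutions (L1 r m n) \<and>
          poly_solutions (L1 r m n) = range (\<lambda>a. smult a (type1 r m (n - 2*r))) \<and>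
          vector_space.dim smult (poly_solutions (L1 r m n)) = 1)
     \<and>
     (\<forall>r n :: int.
        r \<ge> 2 \<longrightarrow> n \<in> {r * j | j. j > 0} \<longrightarrow> n \<ge> r \<longrightarrow>
          type2 r m (n - 2*r) \<noteq> 0 \<and>
          type2 r m (n - 2*r) \<in> poly_solutions (L2 r m n) \<and>
          (1 / real_of_int r + 1 / real_of_int m \<noteq> 1 / 2 \<longrightarrow>
             poly_solutions (L2 r m n) = range (\<lambda>a. smult a (type2 r m (n - 2*r))) \<and>
             vector_space.dim smult (poly_solutions (L2 r m n)) = 1))"
proof (intro conjI allI impI)
  fix r n :: int
  assume r: "r \<ge> 2" and n: "n \<in> {r * j | j. j > 0}" "n \<ge> 2*r"
    and ne: "1 / real_of_int r + 1 / real_of_int m \<noteq> 1 / 2"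
  then obtain i where i: "n = r * i" by auto
  then have "i \<ge> 2" using n(2) r by (simp add: mult.commute[of 2])
  then obtain j where j: "j > 0" and nj: "n = r * (j + 1)"
    using i by (intro that[of "i - 1"]) auto
  note sol = type1_solution[OF r assms j, folded nj]
  show "type1 r m (n - 2*r) \<noteq> 0" "type1 r m (n - 2*r) \<in> poly_solutions (L1 r m n)"
    "poly_solutions (L1 r m n) = range (\<lambda>a. smult a (type1 r m (n - 2*r)))"
    "vector_space.dim smult (poly_solutions (L1 r m n)) = 1"
    by (fact sol(1,2) sol(3,4)[OF ne])+
next
  fix r n :: int
  assume r: "r \<ge> 2" and n: "n \<in> {r * j | j. j > 0}"
  then obtain j where j: "j > 0" and nj: "n = r * j" by auto
  note sol = type2_solution[OF r assms j, folded nj]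
  show "type2 r m (n - 2*r) \<noteq> 0" "type2 r m (n - 2*r) \<in> poly_solutions (L2 r m n)"
    by (fact sol(1,2))+
  assume "1 / real_of_int r + 1 / real_of_int m \<noteq> 1 / 2"
  then show "poly_solutions (L2 r m n) = range (\<lambda>a. smult a (type2 r m (n - 2*r)))"
    "vector_space.dim smult (poly_solutions (L2 r m n)) = 1"
    by (fact sol(3,4))+
qed

end
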